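(* If a group satisfies the translate property, then it is amenable.
   Context: Groups are abstract (discrete) groups. For a function $f$ on a group $G$ and $g\in G$, $(gf)(x)=f(g^{-1}x)$. A non-zero bounded function $f\geq0$ on $G$ satisfies the translate property if for all $n$, $t_1,\dots,t_n\in\mathbf{R}$ and $g_1,\dots,g_n\in G$: $\sum_{i=1}^n t_i g_i f\geq 0$ (pointwise on $G$) implies $\sum_{i=1}^n t_i\geq0$. The group $G$ has the translate property if this holds for every non-zero bounded function $f\geq 0$ on $G$. *)

theory Defs
  imports "HOL-Analysis.Analysis" "HOL-Algebra.Group"
begin

text \<open>
  A function on the group \<open>G\<close> is represented by a function on the ambient type, of which only
  the values on \<open>carrier G\<close> are meaningful; all conditions below are relative to \<open>carrier G\<close>.
\<close>

definition translate :: "('a, 'b) monoid_scheme \<Rightarrow> 'a \<Rightarrow> ('a \<Rightarrow> real) \<Rightarrow> 'a \<Rightarrow> real" where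
  "translate G g f = (\<lambda>x. f (inv\<^bsub>G\<^esub> g \<otimes>\<^bsub>G\<^esub> x))"

definition bounded_funs :: "('a, 'b) monoid_scheme \<Rightarrow> ('a \<Rightarrow> real) set" where
  "bounded_funs G = {f. bounded (f ` carrier G)}"

definition fun_translate_property :: "('a, 'b) monoid_scheme \<Rightarrow> ('a \<Rightarrow> real) \<Rightarrow> bool" where
  "fun_translate_property G f \<longleftrightarrow>
     (\<forall>(n::nat) (t :: nat \<Rightarrow> real) (g :: nat \<Rightarrow> 'a).
        (\<forall>i\<in>{1..n}. g i \<in> carrier G) \<longrightarrow>
        (\<forall>x\<in>carrier G. (\<Sum>i=1..n. t i * translate G (g i) f x) \<ge> 0) \<longrightarrow>
        (\<Sum>i=1..n. t i) \<ge> 0)"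

definition translate_property :: "('a, 'b) monoid_scheme \<Rightarrow> bool" where
  "translate_property G \<longleftrightarrow>
     (\<forall>f\<in>bounded_funs G.
        (\<forall>x\<in>carrier G. f x \<ge> 0) \<longrightarrow> (\<exists>x\<in>carrier G. f x \<noteq> 0) \<longrightarrow>
        fun_translate_property G f)"

text \<open>
  Positivity and linearity force \<open>m f\<close> to depend only on the restriction of \<open>f\<close> to
  \<open>carrier G\<close>, so \<open>m\<close> is a mean on the space of bounded functions on \<open>G\<close>.
\<close>

definition invariant_mean :: "('a, 'b) monoid_scheme \<Rightarrow> (('a \<Rightarrow> real) \<Rightarrow> real) \<Rightarrow> bool" where
  "invariant_mean G m \<longleftrightarrow>
     (\<forall>f\<in>bounded_funs G. \<forall>h\<in>bounded_funs G. m (\<lambda>x. f x + h x) = m f + m h) \<and>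
     (\<forall>f\<in>bounded_funs G. \<forall>c. m (\<lambda>x. c * f x) = c * m f) \<and>
     (\<forall>f\<in>bounded_funs G. (\<forall>x\<in>carrier G. f x \<ge> 0) \<longrightarrow> m f \<ge> 0) \<and>
     m (\<lambda>x. 1) = 1 \<and>
     (\<forall>f\<in>bounded_funs G. \<forall>g\<in>carrier G. m (translate G g f) = m f)"

definition amenable :: "('a, 'b) monoid_scheme \<Rightarrow> bool" where
  "amenable G \<longleftrightarrow> (\<exists>m. invariant_mean G m)"

end

theory Submission imports Defs begin

text \<open>
  The argument rests on Kesten's criterion: a group is amenable if, for every finite set \<open>S\<close>
  containing the identity, the simple random walk with steps in \<open>S\<close> does not lose
  \<open>\<ell>\<^sup>2\<close>-norm at a geometric rate.

  Let \<open>u n\<close> be the \<open>n\<close>-th convolution power of the indicator function of \<open>S\<close>. If the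
  \<open>\<ell>\<^sup>2\<close>-norm of \<open>u n\<close> were at most \<open>q ^ n\<close> for some \<open>q < card S\<close>, then the Green function
  \<open>f = \<Sum> r ^ n u n\<close> would be bounded for some \<open>r > 1 / card S\<close>. But \<open>f - r (\<Sum>s\<in>S. s f) = u 0 \<ge> 0\<close>
  is a combination of translates of \<open>f\<close> whose coefficients sum to \<open>1 - r card S < 0\<close>, against the
  translate property (\<open>walk_energy_growth\<close>).

  Hence for each \<open>q < card S\<close> some step of the walk multiplies the norm by more than \<open>q\<close>. By the
  parallelogram-type inequality \<open>energy_sum_translates\<close>, the function \<open>u n\<close> at that step is
  almost invariant in \<open>\<ell>\<^sup>2\<close> under \<open>S\<close>, and its normalised square is almost invariant in
  \<open>\<ell>\<^sup>1\<close> (\<open>translate_property_imp_reiter\<close>). A limit point of the means defined by these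
  probability functions is an invariant mean (\<open>reiter_imp_amenable\<close>).

  All the functions \<open>u n\<close> have finite support, so the \<open>\<ell>\<^sup>2\<close>-estimates are elementary and
  no operators on Hilbert space appear.
\<close>

section \<open>Finitely supported functions and translation\<close>

definition finsupp :: "('a, 'b) monoid_scheme \<Rightarrow> ('a \<Rightarrow> real) \<Rightarrow> bool" where
  "finsupp G u \<longleftrightarrow> finite {x \<in> carrier G. u x \<noteq> 0}"

lemma finsupp_summable: "finsupp G u \<Longrightarrow> u summable_on carrier G"
  unfolding finsupp_def by (rule finite_nonzero_values_imp_summable_on)

lemma finsupp_mult: "finsupp G u \<Longrightarrow> finsupp G (\<lambda>x. u x * v x)"
  unfolding finsupp_def by (erule finite_subset[rotated]) auto

lemma finsupp_cmult: "finsupp G u \<Longrightarrow> finsupp G (\<lambda>x. c * u x)"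
  unfolding finsupp_def by (erule finite_subset[rotated]) auto

lemma finsupp_divide: "finsupp G u \<Longrightarrow> finsupp G (\<lambda>x. u x / c)"
  unfolding finsupp_def by (erule finite_subset[rotated]) auto

lemma finsupp_power2: "finsupp G u \<Longrightarrow> finsupp G (\<lambda>x. (u x)\<^sup>2)"
  unfolding finsupp_def by (erule finite_subset[rotated]) auto

lemma finsupp_abs: "finsupp G u \<Longrightarrow> finsupp G (\<lambda>x. \<bar>u x\<bar>)"
  unfolding finsupp_def by (erule finite_subset[rotated]) auto

lemma finsupp_add: "finsupp G u \<Longrightarrow> finsupp G v \<Longrightarrow> finsupp G (\<lambda>x. u x + v x)"
  unfolding finsupp_def by (rule finite_subset[of _ "{x \<in> carrier G. u x \<noteq> 0} \<union> {x \<in> carrier G. v x \<noteq> 0}"]) auto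

lemma finsupp_diff: "finsupp G u \<Longrightarrow> finsupp G v \<Longrightarrow> finsupp G (\<lambda>x. u x - v x)"
  unfolding finsupp_def by (rule finite_subset[of _ "{x \<in> carrier G. u x \<noteq> 0} \<union> {x \<in> carrier G. v x \<noteq> 0}"]) auto

lemma finsupp_sum:
  assumes "finite S" "\<And>s. s \<in> S \<Longrightarrow> finsupp G (u s)"
  shows "finsupp G (\<lambda>x. \<Sum>s\<in>S. u s x)"
  using assms
proof (induction S rule: finite_induct)
  case empty
  then show ?case by (simp add: finsupp_def)
next
  case (insert s S)
  then show ?case by (simp add: finsupp_add)
qed

lemmas finsupp_intros =
  finsupp_cmult finsupp_mult finsupp_divide finsupp_power2 finsupp_abs finsupp_add finsupp_diff

context group
begin

lemma bij_betw_inv_mult: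
  assumes "g \<in> carrier G"
  shows "bij_betw (\<lambda>x. inv g \<otimes> x) (carrier G) (carrier G)"
  using assms
  by (intro bij_betw_byWitness[where f' = "\<lambda>x. g \<otimes> x"])
     (auto simp: m_assoc[symmetric])

lemma infsum_translate:
  assumes "g \<in> carrier G"
  shows "(\<Sum>\<^sub>\<infinity>x\<in>carrier G. translate G g u x) = (\<Sum>\<^sub>\<infinity>x\<in>carrier G. u x)"
  unfolding translate_def by (rule infsum_reindex_bij_betw[OF bij_betw_inv_mult[OF assms]])

lemma finsupp_translate:
  assumes "g \<in> carrier G" "finsupp G u"
  shows "finsupp G (translate G g u)"
proof -
  have "{x \<in> carrier G. translate G g u x \<noteq> 0} \<subseteq> (\<lambda>x. g \<otimes> x) ` {x \<in> carrier G. u x \<noteq> 0}"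
  proof
    fix x assume "x \<in> {x \<in> carrier G. translate G g u x \<noteq> 0}"
    then have "x = g \<otimes> (inv g \<otimes> x)" "inv g \<otimes> x \<in> {x \<in> carrier G. u x \<noteq> 0}"
      using assms(1) by (auto simp: translate_def m_assoc[symmetric])
    then show "x \<in> (\<lambda>x. g \<otimes> x) ` {x \<in> carrier G. u x \<noteq> 0}" by blast
  qed
  then show ?thesis
    using assms(2) unfolding finsupp_def by (meson finite_imageI finite_subset)
qed

lemma translate_one: "x \<in> carrier G \<Longrightarrow> translate G \<one> f x = f x"
  by (simp add: translate_def)

lemma translate_in_bounded_funs:
  assumes "g \<in> carrier G" "f \<in> bounded_funs G"
  shows "translate G g f \<in> bounded_funs G"
proof -
  have "translate G g f ` carrier G \<subseteq> f ` carrier G"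
    using assms(1) by (auto simp: translate_def)
  then show ?thesis
    using assms(2) unfolding bounded_funs_def by (auto intro: bounded_subset)
qed

end

text \<open>
  The translate property in terms of a finite set of translations, which replaces the
  enumeration of group elements.
\<close>

lemma (in group) fun_translate_propertyD:
  assumes "fun_translate_property G f" "finite S" "S \<subseteq> carrier G"
    and pos: "\<And>x. x \<in> carrier G \<Longrightarrow> (\<Sum>s\<in>S. c s * translate G s f x) \<ge> 0"
  shows "(\<Sum>s\<in>S. c s) \<ge> 0"
proof -
  obtain g where g: "bij_betw g {1..card S} S"
    using ex_bij_betw_nat_finite_1[OF \<open>finite S\<close>] by blast
  have re: "(\<Sum>i=1..card S. h (g i)) = (\<Sum>s\<in>S. h s)" for h :: "'a \<Rightarrow> real"
    by (rule sum.reindex_bij_betw[OF g])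
  have "\<forall>i\<in>{1..card S}. g i \<in> carrier G"
    using g assms(3) by (auto simp: bij_betw_def)
  moreover have "\<forall>x\<in>carrier G. (\<Sum>i=1..card S. c (g i) * translate G (g i) f x) \<ge> 0"
    using pos re[of "\<lambda>s. c s * translate G s f _"] by simp
  ultimately have "(\<Sum>i=1..card S. c (g i)) \<ge> 0"
    using assms(1)[unfolded fun_translate_property_def,
        rule_format, of "card S" g "\<lambda>i. c (g i)"] by blast
  then show ?thesis by (simp only: re)
qed

section \<open>Energy and random walks\<close>

text \<open>
  \<open>walk G S n x\<close> is the number of words of length \<open>n\<close> over \<open>S\<close> with product \<open>x\<close>, that is, the
  \<open>n\<close>-th convolution power of the indicator function of \<open>S\<close>.
\<close>

primrec walk :: "('a, 'b) monoid_scheme \<Rightarrow> 'a set \<Rightarrow> nat \<Rightarrow> 'a \<Rightarrow> real" where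
  "walk G S 0 = (\<lambda>x. if x = \<one>\<^bsub>G\<^esub> then 1 else 0)"
| "walk G S (Suc n) = (\<lambda>x. \<Sum>s\<in>S. translate G s (walk G S n) x)"

text \<open>The square of the \<open>\<ell>\<^sup>2\<close>-norm on the group.\<close>

definition energy :: "('a, 'b) monoid_scheme \<Rightarrow> ('a \<Rightarrow> real) \<Rightarrow> real" where
  "energy G u = (\<Sum>\<^sub>\<infinity>x\<in>carrier G. (u x)\<^sup>2)"

lemma energy_nonneg: "energy G u \<ge> 0"
  unfolding energy_def by (rule infsum_nonneg) simp

lemma power2_le_energy:
  assumes "finsupp G u" "x \<in> carrier G"
  shows "(u x)\<^sup>2 \<le> energy G u"
proof -
  have "(\<Sum>x\<in>{x}. (u x)\<^sup>2) \<le> (\<Sum>\<^sub>\<infinity>x\<in>carrier G. (u x)\<^sup>2)"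
    using assms by (intro finite_sum_le_infsum finsupp_summable finsupp_power2) auto
  then show ?thesis by (simp add: energy_def)
qed

text \<open>
  Cauchy-Schwarz with a remainder: by Lagrange's identity the deficit in
  \<open>(\<Sum> a i)\<^sup>2 \<le> card S * (\<Sum> (a i)\<^sup>2)\<close> is half the sum of \<open>(a i - a j)\<^sup>2\<close> over all ordered pairs,
  in which the pair \<open>{s, t}\<close> is counted twice.
\<close>

lemma sum_power2_deficit:
  fixes a :: "'i \<Rightarrow> real"
  assumes "finite S" "s \<in> S" "t \<in> S"
  shows "(\<Sum>i\<in>S. a i)\<^sup>2 + (a s - a t)\<^sup>2 \<le> card S * (\<Sum>i\<in>S. (a i)\<^sup>2)"
proof (cases "s = t")
  case True
  then show ?thesis using sum_squared_le_sum_of_squares[of a S] by (simp add: mult.commute)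
next
  case False
  have lagrange: "(\<Sum>i\<in>S. \<Sum>j\<in>S. (a i - a j)\<^sup>2) = 2 * (card S * (\<Sum>i\<in>S. (a i)\<^sup>2) - (\<Sum>i\<in>S. a i)\<^sup>2)"
    by (simp add: power2_diff sum.distrib sum_subtractf power2_eq_square sum_product
        sum_distrib_left sum_distrib_right algebra_simps)
  have "(a s - a t)\<^sup>2 + (a t - a s)\<^sup>2 = (\<Sum>(i,j)\<in>{(s,t),(t,s)}. (a i - a j)\<^sup>2)"
    using False by simp
  also have "\<dots> \<le> (\<Sum>(i,j)\<in>S\<times>S. (a i - a j)\<^sup>2)"
    using assms by (intro sum_mono2) auto
  also have "\<dots> = (\<Sum>i\<in>S. \<Sum>j\<in>S. (a i - a j)\<^sup>2)"
    by (simp add: sum.cartesian_product)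
  finally show ?thesis
    unfolding lagrange by (simp add: power2_commute[of "a t"])
qed

lemma infsum_finite_sum:
  fixes u :: "'i \<Rightarrow> 'a \<Rightarrow> real"
  assumes "finite S" "\<And>s. s \<in> S \<Longrightarrow> u s summable_on A"
  shows "(\<Sum>\<^sub>\<infinity>x\<in>A. \<Sum>s\<in>S. u s x) = (\<Sum>s\<in>S. \<Sum>\<^sub>\<infinity>x\<in>A. u s x)"
proof -
  have "((\<lambda>x. \<Sum>s\<in>S. u s x) has_sum (\<Sum>s\<in>S. \<Sum>\<^sub>\<infinity>x\<in>A. u s x)) A"
    using assms by (induction S rule: finite_induct) (auto intro: has_sum_add has_sum_infsum)
  then show ?thesis by (rule infsumI)
qed

context group
begin

lemma energy_translate: "g \<in> carrier G \<Longrightarrow> energy G (translate G g u) = energy G u"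
  using infsum_translate[of g "\<lambda>x. (u x)\<^sup>2"] by (simp add: energy_def translate_def)

text \<open>
  The average of the translates of \<open>u\<close> over \<open>S\<close> can have almost the same norm as \<open>u\<close> only if
  the translates are nearly equal, hence nearly equal to \<open>u\<close> itself because \<open>\<one> \<in> S\<close>.
\<close>

lemma energy_sum_translates:
  assumes "finsupp G u" "finite S" "S \<subseteq> carrier G" "\<one> \<in> S" "g \<in> S"
  shows "energy G (\<lambda>x. \<Sum>s\<in>S. translate G s u x) + energy G (\<lambda>x. translate G g u x - u x)
    \<le> (card S)\<^sup>2 * energy G u"
proof -
  have fs: "finsupp G (translate G s u)" if "s \<in> S" for s
    using that assms finsupp_translate by blast
  note fin = fs[OF \<open>g \<in> S\<close>] finsupp_sum[of S G "\<lambda>s. translate G s u", OF \<open>finite S\<close> fs]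
    finsupp_sum[of S G "\<lambda>s x. (translate G s u x)\<^sup>2", OF \<open>finite S\<close> finsupp_power2[OF fs]]
  have "energy G (\<lambda>x. \<Sum>s\<in>S. translate G s u x) + energy G (\<lambda>x. translate G g u x - u x)
    = (\<Sum>\<^sub>\<infinity>x\<in>carrier G. (\<Sum>s\<in>S. translate G s u x)\<^sup>2 + (translate G g u x - u x)\<^sup>2)"
    unfolding energy_def
    by (intro infsum_add[symmetric] finsupp_summable finsupp_intros fin assms(1))
  also have "\<dots> \<le> (\<Sum>\<^sub>\<infinity>x\<in>carrier G. card S * (\<Sum>s\<in>S. (translate G s u x)\<^sup>2))"
  proof (intro infsum_mono finsupp_summable finsupp_intros fin assms(1))
    fix x assume "x \<in> carrier G"
    then show "(\<Sum>s\<in>S. translate G s u x)\<^sup>2 + (translate G g u x - u x)\<^sup>2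
        \<le> card S * (\<Sum>s\<in>S. (translate G s u x)\<^sup>2)"
      using sum_power2_deficit[OF \<open>finite S\<close> \<open>g \<in> S\<close> \<open>\<one> \<in> S\<close>, of "\<lambda>s. translate G s u x"]
      by (simp add: translate_one)
  qed
  also have "\<dots> = card S * (\<Sum>\<^sub>\<infinity>x\<in>carrier G. \<Sum>s\<in>S. (translate G s u x)\<^sup>2)"
    by (rule infsum_cmult_right')
  also have "\<dots> = card S * (\<Sum>s\<in>S. energy G (translate G s u))"
    unfolding energy_def
    by (subst infsum_finite_sum[OF assms(2) finsupp_summable[OF finsupp_power2[OF fs]]]) auto
  also have "\<dots> = (card S)\<^sup>2 * energy G u"
    using assms(3) by (simp add: energy_translate subset_iff power2_eq_square)
  finally show ?thesis by simp
qed

lemma finsupp_walk: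
  assumes "finite S" "S \<subseteq> carrier G"
  shows "finsupp G (walk G S n)"
proof (induction n)
  case 0
  have "finite {x \<in> carrier G. walk G S 0 x \<noteq> 0}"
    by (rule finite_subset[of _ "{\<one>}"]) auto
  then show ?case by (simp only: finsupp_def)
next
  case (Suc n)
  then show ?case
    using assms by (auto intro!: finsupp_sum finsupp_translate)
qed

lemma walk_nonneg:
  assumes "S \<subseteq> carrier G"
  shows "x \<in> carrier G \<Longrightarrow> walk G S n x \<ge> 0"
proof (induction n arbitrary: x)
  case (Suc n)
  then show ?case
    using assms by (auto intro!: sum_nonneg simp: translate_def subset_iff)
qed simp

lemma energy_walk_0: "energy G (walk G S 0) = 1"
proof -
  have "energy G (walk G S 0) = (\<Sum>\<^sub>\<infinity>x\<in>{\<one>}. 1)"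
    unfolding energy_def by (rule infsum_cong_neutral) auto
  then show ?thesis by simp
qed

text \<open>
  Here the translate property enters. If the energy of the walk grew at most by the factor
  \<open>q\<^sup>2\<close> in every step, then \<open>walk G S n \<le> q ^ n\<close> pointwise, and for \<open>r < 1 / q\<close> the Green function
  \<open>f = \<Sum> r ^ n walk G S n\<close> would be bounded. It satisfies \<open>f - r (\<Sum>s\<in>S. s f) = \<delta>\<close>, where \<open>\<delta> \<ge> 0\<close>
  is the point mass at \<open>\<one>\<close>, while the coefficients on the left sum to \<open>1 - r card S\<close>. This is
  negative if also \<open>r > 1 / card S\<close>, and both conditions on \<open>r\<close> can be met because \<open>q < card S\<close>.
\<close>

lemma walk_energy_growth:
  fixes q :: real
  assumes tp: "translate_property G"
    and S: "finite S" "S \<subseteq> carrier G" "\<one> \<in> S" and q: "0 < q" "q < card S"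
  shows "\<exists>n. q\<^sup>2 * energy G (walk G S n) < energy G (walk G S (Suc n))"
proof (rule ccontr)
  assume "\<not> ?thesis"
  then have step: "energy G (walk G S (Suc n)) \<le> q\<^sup>2 * energy G (walk G S n)" for n
    by (meson not_less)
  have en: "energy G (walk G S n) \<le> (q ^ n)\<^sup>2" for n
  proof (induction n)
    case 0
    show ?case by (simp add: energy_walk_0 del: walk.simps)
  next
    case (Suc n)
    have "energy G (walk G S (Suc n)) \<le> q\<^sup>2 * (q ^ n)\<^sup>2"
      using step[of n] mult_left_mono[OF Suc zero_le_power2[of q]] by (rule order_trans)
    then show ?case by (simp add: power_mult_distrib)
  qed
  have decay: "walk G S n x \<le> q ^ n" if "x \<in> carrier G" for n x
  proof (rule power2_le_imp_le)
    show "(walk G S n x)\<^sup>2 \<le> (q ^ n)\<^sup>2"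
      using power2_le_energy[OF finsupp_walk[OF S(1,2)] that] en order_trans by blast
  qed (use q in simp)

  \<comment> \<open>Any number strictly between \<open>1 / card S\<close> and \<open>1 / q\<close> would do.\<close>
  define r where "r = 2 / (q + card S)"
  have r: "0 < r" "r * q < 1" "r * card S > 1"
    using q by (auto simp: r_def field_simps)
  define f where "f x = (\<Sum>n. r ^ n * walk G S n x)" for x
  have geo: "summable (\<lambda>n. (r * q) ^ n)"
    using r q by (intro summable_geometric) auto
  have term_le: "r ^ n * walk G S n x \<le> (r * q) ^ n" if "x \<in> carrier G" for n x
    using decay[OF that, of n] r by (simp add: power_mult_distrib mult_left_mono)
  have term_ge: "0 \<le> r ^ n * walk G S n x" if "x \<in> carrier G" for n x
    using walk_nonneg[OF S(2) that] r by simp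
  have sm: "summable (\<lambda>n. r ^ n * walk G S n x)" if "x \<in> carrier G" for x
    by (rule summable_comparison_test'[OF geo, of 0]) (use term_le term_ge that in auto)
  have f_nonneg: "f x \<ge> 0" if "x \<in> carrier G" for x
    unfolding f_def using sm term_ge that by (intro suminf_nonneg) auto
  have f_le: "f x \<le> (\<Sum>n. (r * q) ^ n)" if "x \<in> carrier G" for x
    unfolding f_def using sm term_le geo that by (intro suminf_le) auto
  have "f \<in> bounded_funs G"
    unfolding bounded_funs_def bounded_iff mem_Collect_eq
    by (intro exI[of _ "\<Sum>n. (r * q) ^ n"]) (use f_nonneg f_le in auto)

  have resolvent: "f x - r * (\<Sum>s\<in>S. translate G s f x) = walk G S 0 x" if x: "x \<in> carrier G" for x
  proof -
    have "(\<Sum>s\<in>S. translate G s f x) = (\<Sum>s\<in>S. \<Sum>n. r ^ n * walk G S n (inv s \<otimes> x))"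
      by (simp add: f_def translate_def)
    also have "\<dots> = (\<Sum>n. \<Sum>s\<in>S. r ^ n * walk G S n (inv s \<otimes> x))"
      using S x by (intro suminf_sum[symmetric] sm) auto
    also have "\<dots> = (\<Sum>n. r ^ n * walk G S (Suc n) x)"
      by (simp add: translate_def sum_distrib_left)
    finally have *: "(\<Sum>s\<in>S. translate G s f x) = (\<Sum>n. r ^ n * walk G S (Suc n) x)" .
    have "summable (\<lambda>n. r ^ Suc n * walk G S (Suc n) x)"
      using sm[OF x] by (subst summable_Suc_iff)
    then have "summable (\<lambda>n. r * (r ^ n * walk G S (Suc n) x))"
      by (simp only: power_Suc mult.assoc)
    then have "summable (\<lambda>n. r ^ n * walk G S (Suc n) x)"
      using r by (subst (asm) summable_cmult_iff) auto
    then have "r * (\<Sum>n. r ^ n * walk G S (Suc n) x) = (\<Sum>n. r * (r ^ n * walk G S (Suc n) x))"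
      by (rule suminf_mult[symmetric])
    also have "\<dots> = (\<Sum>n. r ^ Suc n * walk G S (Suc n) x)"
      by (simp only: power_Suc mult.assoc)
    also have "\<dots> = f x - r ^ 0 * walk G S 0 x"
      unfolding f_def by (rule suminf_split_head[OF sm[OF x]])
    finally show ?thesis unfolding * by simp
  qed
  \<comment> \<open>The translate property only speaks of non-zero functions.\<close>
  have "f \<one> \<ge> 1"
  proof -
    have "r * (\<Sum>s\<in>S. translate G s f \<one>) \<ge> 0"
      using r S f_nonneg by (intro mult_nonneg_nonneg sum_nonneg) (auto simp: translate_def)
    then show ?thesis using resolvent[of \<one>] by simp
  qed
  then have "\<exists>x\<in>carrier G. f x \<noteq> 0"
    by (intro bexI[of _ \<one>]) auto
  then have "fun_translate_property G f"
    using tp \<open>f \<in> bounded_funs G\<close> f_nonneg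
    unfolding translate_property_def by blast
  moreover have "(\<Sum>s\<in>S. ((if s = \<one> then 1 else 0) - r) * translate G s f x) \<ge> 0"
    if x: "x \<in> carrier G" for x
  proof -
    have "(\<Sum>s\<in>S. ((if s = \<one> then 1 else 0) - r) * translate G s f x)
        = (\<Sum>s\<in>S. (if s = \<one> then translate G s f x else 0)) - r * (\<Sum>s\<in>S. translate G s f x)"
      unfolding sum_distrib_left sum_subtractf[symmetric]
      by (rule sum.cong) (auto simp: algebra_simps)
    also have "\<dots> = walk G S 0 x"
      using S x resolvent[OF x] by (simp add: translate_one)
    finally show ?thesis by simp
  qed
  ultimately have "(\<Sum>s\<in>S. (if s = \<one> then 1 else 0) - r) \<ge> 0"
    by (rule fun_translate_propertyD[OF _ S(1,2)])
  then have "1 - card S * r \<ge> 0"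
    using S by (simp add: sum_subtractf)
  then show False using r by (simp add: mult.commute)
qed

end

section \<open>Almost invariant functions\<close>

text \<open>
  This is Reiter's condition: almost invariant probability functions, here with finite support.
\<close>

definition reiter :: "('a, 'b) monoid_scheme \<Rightarrow> bool" where
  "reiter G \<longleftrightarrow> (\<forall>S \<epsilon>. finite S \<longrightarrow> S \<subseteq> carrier G \<longrightarrow> 0 < \<epsilon> \<longrightarrow> (
    \<exists>p. finsupp G p \<and> (\<forall>x\<in>carrier G. p x \<ge> 0) \<and> (\<Sum>\<^sub>\<infinity>x\<in>carrier G. p x) = 1 \<and>
    (\<forall>g\<in>S. (\<Sum>\<^sub>\<infinity>x\<in>carrier G. \<bar>translate G g p x - p x\<bar>) \<le> \<epsilon>)))"

context group
begin

text \<open>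
  In \<open>\<ell>\<^sup>2\<close> the inequality of \<open>energy_sum_translates\<close> turns the growth of the walk into almost
  invariance: if the energy is multiplied by nearly \<open>(card T)\<^sup>2\<close> in one step, where
  \<open>T = insert \<one> S\<close>, then every displacement \<open>g u - u\<close> has small energy. Squaring the almost invariant vector \<open>u\<close> passes from
  \<open>\<ell>\<^sup>2\<close> to \<open>\<ell>\<^sup>1\<close>, since \<open>\<bar>v\<^sup>2 - u\<^sup>2\<bar> = \<bar>v - u\<bar> \<bar>v + u\<bar>\<close>.
\<close>

lemma translate_property_imp_reiter:
  assumes tp: "translate_property G"
  shows "reiter G"
  unfolding reiter_def
proof (intro allI impI)
  fix S :: "'a set" and \<epsilon> :: real
  assume S: "finite S" "S \<subseteq> carrier G" and "0 < \<epsilon>"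
  \<comment> \<open>The displacement estimate compares translates with \<open>u\<close> itself, so \<open>\<one>\<close> has to take part.\<close>
  define T where "T = insert \<one> S"
  have T: "finite T" "T \<subseteq> carrier G" "\<one> \<in> T" using S by (auto simp: T_def)
  have "card T > 0" using T card_gt_0_iff[of T] by blast
  then have k: "card T \<ge> 1" by simp
  \<comment> \<open>The final bound is \<open>5 \<eta> / 2\<close>; \<open>\<eta> < 1\<close> keeps \<open>q\<close> positive.\<close>
  define \<eta> where "\<eta> = min (\<epsilon> / 3) (1/2)"
  have \<eta>: "0 < \<eta>" "\<eta> < 1" "3 * \<eta> \<le> \<epsilon>" using \<open>0 < \<epsilon>\<close> by (auto simp: \<eta>_def)
  have e2: "\<eta>\<^sup>2 < 1" using \<eta> by (simp add: power_less_one_iff)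
  have k2: "1 \<le> (real (card T))\<^sup>2" using k by simp
  define q where "q = sqrt ((card T)\<^sup>2 - \<eta>\<^sup>2)"
  have q2: "q\<^sup>2 = (card T)\<^sup>2 - \<eta>\<^sup>2" using e2 k2 by (simp add: q_def)
  have q: "0 < q" using e2 k2 by (simp add: q_def)
  have "q < card T"
    by (rule power2_less_imp_less) (use q2 \<eta> in auto)
  then obtain n where n: "q\<^sup>2 * energy G (walk G T n) < energy G (walk G T (Suc n))"
    using walk_energy_growth[OF tp T q] by blast
  define u where "u = walk G T n"
  have u: "finsupp G u" unfolding u_def by (rule finsupp_walk[OF T(1,2)])
  define N where "N = energy G u"
  have displacement: "energy G (\<lambda>x. translate G g u x - u x) < \<eta>\<^sup>2 * N" if "g \<in> T" for g
    using energy_sum_translates[OF u T that] n unfolding q2 N_def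
    by (simp add: u_def algebra_simps)
  \<comment> \<open>The estimate is strict, so the walk cannot vanish and \<open>u\<^sup>2\<close> can be normalised.\<close>
  have "0 < \<eta>\<^sup>2 * N"
    using displacement[OF T(3)] energy_nonneg[of G "\<lambda>x. translate G \<one> u x - u x"] by linarith
  then have N: "0 < N" using \<eta> by (simp add: zero_less_mult_iff)
  define p where "p x = (u x)\<^sup>2 / N" for x
  have p: "finsupp G p" unfolding p_def by (intro finsupp_intros u)
  have tot: "(\<Sum>\<^sub>\<infinity>x\<in>carrier G. p x) = 1"
  proof -
    have "(\<Sum>\<^sub>\<infinity>x\<in>carrier G. p x) = (\<Sum>\<^sub>\<infinity>x\<in>carrier G. (1/N) * (u x)\<^sup>2)"
      by (simp add: p_def)
    also have "\<dots> = (1/N) * N"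
      unfolding N_def energy_def by (rule infsum_cmult_right')
    finally show ?thesis using N by simp
  qed
  have "(\<Sum>\<^sub>\<infinity>x\<in>carrier G. \<bar>translate G g p x - p x\<bar>) \<le> \<epsilon>" if "g \<in> S" for g
  proof -
    have g: "g \<in> T" "g \<in> carrier G" using that S by (auto simp: T_def)
    define v where "v = translate G g u"
    have v: "finsupp G v" unfolding v_def by (rule finsupp_translate[OF g(2) u])
    have pv: "translate G g p x = (v x)\<^sup>2 / N" for x by (simp add: p_def v_def translate_def)
    define c where "c = 1 / (2 * \<eta> * N)"
    define d where "d = \<eta> / N"
    \<comment> \<open>The weights come from \<open>2 \<eta> a b \<le> a\<^sup>2 + \<eta>\<^sup>2 b\<^sup>2\<close>; they balance because the energy of \<open>v - u\<close> is
      at most \<open>\<eta>\<^sup>2 N\<close>. This pointwise bound replaces the Cauchy-Schwarz inequality for series.\<close>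
    have pw: "\<bar>translate G g p x - p x\<bar> \<le> c * (v x - u x)\<^sup>2 + d * ((v x)\<^sup>2 + (u x)\<^sup>2)" for x
    proof -
      define a b where "a = \<bar>v x - u x\<bar>" and "b = \<bar>v x + u x\<bar>"
      have ab: "a\<^sup>2 = (v x - u x)\<^sup>2" "b\<^sup>2 = (v x + u x)\<^sup>2" by (auto simp: a_def b_def)
      have "\<bar>translate G g p x - p x\<bar> = a * b / N"
        unfolding pv p_def a_def b_def using N
        by (simp add: abs_mult[symmetric] diff_divide_distrib[symmetric] power2_eq_square algebra_simps abs_divide)
      moreover have "2 * \<eta> * (a * b) \<le> a\<^sup>2 + \<eta>\<^sup>2 * b\<^sup>2"
        using sum_squares_bound[of a "\<eta> * b"] by (simp add: power_mult_distrib algebra_simps)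
      moreover have "b\<^sup>2 \<le> 2 * ((v x)\<^sup>2 + (u x)\<^sup>2)"
        unfolding ab using sum_squares_bound[of "v x" "u x"] by (simp add: power2_sum)
      then have "\<eta>\<^sup>2 * b\<^sup>2 \<le> \<eta>\<^sup>2 * (2 * ((v x)\<^sup>2 + (u x)\<^sup>2))"
        by (intro mult_left_mono) auto
      ultimately have "2 * \<eta> * (a * b) \<le> (v x - u x)\<^sup>2 + 2 * \<eta>\<^sup>2 * ((v x)\<^sup>2 + (u x)\<^sup>2)"
        unfolding ab by linarith
      then have "2 * \<eta> * (a * b) / (2 * \<eta> * N)
          \<le> ((v x - u x)\<^sup>2 + 2 * \<eta>\<^sup>2 * ((v x)\<^sup>2 + (u x)\<^sup>2)) / (2 * \<eta> * N)"
        using \<eta> N by (intro divide_right_mono) auto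
      also have "2 * \<eta> * (a * b) / (2 * \<eta> * N) = a * b / N" using \<eta> by simp
      also have "((v x - u x)\<^sup>2 + 2 * \<eta>\<^sup>2 * ((v x)\<^sup>2 + (u x)\<^sup>2)) / (2 * \<eta> * N)
          = c * (v x - u x)\<^sup>2 + d * ((v x)\<^sup>2 + (u x)\<^sup>2)"
        using \<eta> N by (simp add: c_def d_def field_simps power2_eq_square)
      finally show ?thesis using \<open>\<bar>translate G g p x - p x\<bar> = a * b / N\<close> by simp
    qed
    have "(\<Sum>\<^sub>\<infinity>x\<in>carrier G. \<bar>translate G g p x - p x\<bar>)
        \<le> (\<Sum>\<^sub>\<infinity>x\<in>carrier G. c * (v x - u x)\<^sup>2 + d * ((v x)\<^sup>2 + (u x)\<^sup>2))"
      by (intro infsum_mono finsupp_summable finsupp_intros finsupp_translate g p u v pw)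
    also have "\<dots> = (\<Sum>\<^sub>\<infinity>x\<in>carrier G. c * (v x - u x)\<^sup>2) + (\<Sum>\<^sub>\<infinity>x\<in>carrier G. d * ((v x)\<^sup>2 + (u x)\<^sup>2))"
      by (intro infsum_add finsupp_summable finsupp_intros u v)
    also have "\<dots> = c * energy G (\<lambda>x. v x - u x) + d * (\<Sum>\<^sub>\<infinity>x\<in>carrier G. (v x)\<^sup>2 + (u x)\<^sup>2)"
      by (simp add: infsum_cmult_right' energy_def)
    also have "(\<Sum>\<^sub>\<infinity>x\<in>carrier G. (v x)\<^sup>2 + (u x)\<^sup>2) = energy G v + energy G u"
      unfolding energy_def by (intro infsum_add finsupp_summable finsupp_intros u v)
    also have "energy G v = N" by (simp add: v_def N_def energy_translate g)
    also have "c * energy G (\<lambda>x. v x - u x) + d * (N + energy G u) \<le> c * (\<eta>\<^sup>2 * N) + d * (N + N)"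
      using displacement[OF g(1)] \<eta> N
      by (intro add_mono mult_left_mono) (auto simp: v_def c_def d_def N_def)
    also have "\<dots> = \<eta> / 2 + 2 * \<eta>" using \<eta> N by (simp add: c_def d_def field_simps power2_eq_square)
    also have "\<dots> \<le> \<epsilon>" using \<eta> by simp
    finally show ?thesis .
  qed
  then show "\<exists>p. finsupp G p \<and> (\<forall>x\<in>carrier G. p x \<ge> 0) \<and> (\<Sum>\<^sub>\<infinity>x\<in>carrier G. p x) = 1 \<and>
      (\<forall>g\<in>S. (\<Sum>\<^sub>\<infinity>x\<in>carrier G. \<bar>translate G g p x - p x\<bar>) \<le> \<epsilon>)"
    using p tot N by (intro exI[of _ p]) (auto simp: p_def)
qed

end

section \<open>From almost invariant functions to an invariant mean\<close>

lemma compact_box_fun: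
  fixes B :: "'i \<Rightarrow> real"
  shows "compact {m :: 'i \<Rightarrow> real. \<forall>i. m i \<in> {- B i..B i}}"
proof -
  have "compactin (product_topology (\<lambda>i::'i. euclidean :: real topology) UNIV) (PiE UNIV (\<lambda>i. {- B i..B i}))"
    by (subst compactin_PiE) auto
  then show ?thesis
    by (simp add: euclidean_product_topology PiE_UNIV_domain Pi_def)
qed

lemma bounded_funs_add:
  "f \<in> bounded_funs G \<Longrightarrow> h \<in> bounded_funs G \<Longrightarrow> (\<lambda>x. f x + h x) \<in> bounded_funs G"
  unfolding bounded_funs_def by (auto intro: bounded_plus_comp)

lemma bounded_funs_cmult:
  "f \<in> bounded_funs G \<Longrightarrow> (\<lambda>x. c * f x) \<in> bounded_funs G"
  unfolding bounded_funs_def using bounded_scaling[of "f ` carrier G" c] by (simp add: image_image)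

lemma bounded_funs_const: "(\<lambda>x. c) \<in> bounded_funs G"
  unfolding bounded_funs_def by (auto simp: bounded_iff)

text \<open>
  The means \<open>f \<mapsto> \<Sum> p f\<close> given by almost invariant probability functions \<open>p\<close> lie in a product of
  compact intervals, and \<open>g\<close> moves their value at \<open>f\<close> by at most \<open>\<parallel>f\<parallel>\<close> times the
  \<open>\<ell>\<^sup>1\<close>-displacement of \<open>p\<close>. Being a mean and being invariant up to a given error are closed
  conditions for pointwise convergence, so by Tychonoff's theorem and the finite intersection
  property some mean is invariant up to every error.
\<close>

lemma (in group) reiter_imp_amenable:
  assumes "reiter G"
  shows "amenable G"
proof -
  define V where "V = bounded_funs G"
  note V_closed = bounded_funs_add[of _ G, folded V_def] bounded_funs_cmult[of _ G, folded V_def]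
    bounded_funs_const[of _ G, folded V_def] translate_in_bounded_funs[folded V_def]
  have "\<forall>f. \<exists>b. f \<in> V \<longrightarrow> (\<forall>x\<in>carrier G. \<bar>f x\<bar> \<le> b)"
    by (auto simp: V_def bounded_funs_def bounded_iff)
  then obtain B where B: "\<And>f x. f \<in> V \<Longrightarrow> x \<in> carrier G \<Longrightarrow> \<bar>f x\<bar> \<le> B f" by metis
  have B_nonneg: "B f \<ge> 0" if "f \<in> V" for f
    using B[OF that, of \<one>] by (simp add: order_trans[OF abs_ge_zero])
  \<comment> \<open>Unbounded functions get the value 0, so that all coordinates range over compact intervals.\<close>
  define K where "K = {m. \<forall>f. m f \<in> {- (if f \<in> V then B f else 0)..(if f \<in> V then B f else 0)}}"
  define M where "M = K \<inter> {m :: ('a \<Rightarrow> real) \<Rightarrow> real.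
     (\<forall>f\<in>V. \<forall>h\<in>V. m (\<lambda>x. f x + h x) = m f + m h) \<and>
     (\<forall>f\<in>V. \<forall>c. m (\<lambda>x. c * f x) = c * m f) \<and>
     (\<forall>f\<in>V. (\<forall>x\<in>carrier G. f x \<ge> 0) \<longrightarrow> 0 \<le> m f) \<and>
     m (\<lambda>x. 1) = 1}"
  define E where "E = (\<lambda>(g, k::nat). {m :: ('a \<Rightarrow> real) \<Rightarrow> real.
     \<forall>f\<in>V. \<bar>m (translate G g f) - m f\<bar> \<le> B f / Suc k})"
  have cont: "continuous_on UNIV (\<lambda>m :: ('a \<Rightarrow> real) \<Rightarrow> real. m f)" for f
    by (rule continuous_on_product_coordinates)
  have "compact K" unfolding K_def by (rule compact_box_fun)
  then have M: "compact M"
    unfolding M_def Ball_def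
    by (intro compact_Int_closed closed_Collect_conj closed_Collect_all closed_Collect_imp
        closed_Collect_eq closed_Collect_le open_Collect_const continuous_intros cont)
  have E: "closed (E i)" for i
    unfolding E_def Ball_def
    by (cases i) (auto intro!: closed_Collect_all closed_Collect_imp
        closed_Collect_le open_Collect_const continuous_intros cont)
  have fip: "M \<inter> (\<Inter>i\<in>J. E i) \<noteq> {}" if J: "finite J" "J \<subseteq> carrier G \<times> UNIV" for J
  proof -
    define k where "k = Max (insert 0 (snd ` J))"
    have k: "j \<le> k" if "(g, j) \<in> J" for g j
      unfolding k_def using J that by (intro Max_ge) (auto intro: rev_image_eqI)
    obtain p where p: "finsupp G p" "\<And>x. x \<in> carrier G \<Longrightarrow> p x \<ge> 0" "(\<Sum>\<^sub>\<infinity>x\<in>carrier G. p x) = 1"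
      and inv: "\<And>g. g \<in> fst ` J \<Longrightarrow> (\<Sum>\<^sub>\<infinity>x\<in>carrier G. \<bar>translate G g p x - p x\<bar>) \<le> 1 / Suc k"
      using \<open>reiter G\<close>[unfolded reiter_def, rule_format, of "fst ` J" "1 / Suc k"] J
      by fastforce
    define m where "m f = (if f \<in> V then \<Sum>\<^sub>\<infinity>x\<in>carrier G. p x * f x else 0)" for f
    have pabs: "\<bar>m f\<bar> \<le> B f" if "f \<in> V" for f
    proof -
      have "\<bar>m f\<bar> \<le> (\<Sum>\<^sub>\<infinity>x\<in>carrier G. \<bar>p x * f x\<bar>)"
        using that norm_infsum_bound[of "\<lambda>x. p x * f x" "carrier G"]
        by (simp add: m_def finsupp_summable finsupp_intros p)
      also have "\<dots> \<le> (\<Sum>\<^sub>\<infinity>x\<in>carrier G. B f * p x)"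
      proof (intro infsum_mono finsupp_summable finsupp_intros p)
        fix x assume "x \<in> carrier G"
        then show "\<bar>p x * f x\<bar> \<le> B f * p x"
          using B[OF that] p(2) by (simp add: abs_mult mult.commute[of "B f"] mult_left_mono)
      qed
      also have "\<dots> = B f" by (simp add: infsum_cmult_right' p)
      finally show ?thesis .
    qed
    have "m \<in> K" unfolding K_def using pabs by (auto simp: m_def abs_le_iff minus_le_iff)
    moreover have "m (\<lambda>x. f x + h x) = m f + m h" if "f \<in> V" "h \<in> V" for f h
      using that by (simp add: m_def V_closed distrib_left infsum_add finsupp_summable finsupp_intros p)
    moreover have "m (\<lambda>x. c * f x) = c * m f" if "f \<in> V" for f c
      using that by (simp add: m_def V_closed mult.left_commute[of _ c] infsum_cmult_right')
    moreover have "0 \<le> m f" if "f \<in> V" "\<forall>x\<in>carrier G. f x \<ge> 0" for f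
      using that p by (auto simp: m_def intro!: infsum_nonneg)
    moreover have "m (\<lambda>x. 1) = 1" using p by (simp add: m_def V_closed)
    ultimately have "m \<in> M" unfolding M_def by auto
    moreover have "m \<in> E (g, j)" if "(g, j) \<in> J" for g j
    proof -
      have g: "g \<in> carrier G" "g \<in> fst ` J" using that J by (auto intro: rev_image_eqI)
      have "\<bar>m (translate G g f) - m f\<bar> \<le> B f / Suc j" if f: "f \<in> V" for f
      proof -
        let ?D = "\<lambda>x. p x - translate G g p x"
        have D: "finsupp G ?D" by (intro finsupp_intros finsupp_translate g p)
        have tf: "translate G g f \<in> V" by (rule V_closed(4)[OF g(1) f])
        have "m f = (\<Sum>\<^sub>\<infinity>x\<in>carrier G. translate G g (\<lambda>x. p x * f x) x)"
          using f by (simp add: m_def infsum_translate g)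
        then have mf: "m f = (\<Sum>\<^sub>\<infinity>x\<in>carrier G. translate G g p x * translate G g f x)"
          by (simp add: translate_def)
        have "m (translate G g f)
            = (\<Sum>\<^sub>\<infinity>x\<in>carrier G. ?D x * translate G g f x + translate G g p x * translate G g f x)"
          using tf by (simp add: m_def algebra_simps)
        also have "\<dots> = (\<Sum>\<^sub>\<infinity>x\<in>carrier G. ?D x * translate G g f x) + m f"
          unfolding mf
          by (intro infsum_add finsupp_summable finsupp_mult[OF D]
              finsupp_mult[OF finsupp_translate[OF g(1) p(1)]])
        finally have "m (translate G g f) - m f = (\<Sum>\<^sub>\<infinity>x\<in>carrier G. ?D x * translate G g f x)"
          by simp
        then have "\<bar>m (translate G g f) - m f\<bar> \<le> (\<Sum>\<^sub>\<infinity>x\<in>carrier G. \<bar>?D x * translate G g f x\<bar>)"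
          using norm_infsum_bound[of "\<lambda>x. ?D x * translate G g f x" "carrier G"]
          by (simp add: finsupp_summable finsupp_mult[OF D] finsupp_abs)
        also have "\<dots> \<le> (\<Sum>\<^sub>\<infinity>x\<in>carrier G. B f * \<bar>translate G g p x - p x\<bar>)"
        proof (intro infsum_mono finsupp_summable finsupp_intros finsupp_translate g p)
          fix x assume "x \<in> carrier G"
          then have "\<bar>translate G g f x\<bar> \<le> B f" using B[OF f] g by (simp add: translate_def)
          then show "\<bar>?D x * translate G g f x\<bar> \<le> B f * \<bar>translate G g p x - p x\<bar>"
            by (simp add: abs_mult abs_minus_commute mult.commute[of "B f"] mult_left_mono)
        qed
        also have "\<dots> \<le> B f * (1 / Suc k)"
          unfolding infsum_cmult_right' using inv[OF g(2)] B_nonneg[OF f] by (rule mult_left_mono)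
        also have "\<dots> \<le> B f / Suc j"
          using k[OF \<open>(g, j) \<in> J\<close>] B_nonneg[OF f] by (simp add: frac_le)
        finally show ?thesis .
      qed
      then show ?thesis by (simp add: E_def)
    qed
    ultimately show ?thesis by force
  qed
  have "M \<inter> (\<Inter>i\<in>carrier G \<times> UNIV. E i) \<noteq> {}"
    by (rule compact_imp_fip_image[where f = E, OF M E fip])
  then obtain m where m: "m \<in> M" "\<And>g k. g \<in> carrier G \<Longrightarrow> m \<in> E (g, k)" by blast
  have "m (translate G g f) = m f" if "f \<in> V" "g \<in> carrier G" for f g
  proof -
    have "(\<lambda>k. B f / Suc k) \<longlonglongrightarrow> 0"
      by (rule LIMSEQ_Suc[OF lim_const_over_n])
    moreover have "\<bar>m (translate G g f) - m f\<bar> \<le> B f / Suc k" for k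
      using m(2)[OF that(2), of k] that(1) by (simp add: E_def)
    ultimately have "\<bar>m (translate G g f) - m f\<bar> \<le> 0"
      by (intro LIMSEQ_le_const) auto
    then show ?thesis by simp
  qed
  then have "invariant_mean G m"
    using m(1) unfolding invariant_mean_def M_def V_def by blast
  then show ?thesis unfolding amenable_def by blast
qed

theorem theorem18:
  fixes G :: "('a, 'b) monoid_scheme"
  assumes "group G"
    and "translate_property G"
  shows "amenable G"
proof -
  interpret group G by fact
  show ?thesis
    by (rule reiter_imp_amenable[OF translate_property_imp_reiter[OF assms(2)]])
qed

end
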